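(* Let $\mathcal{Y}$ be a finite set and let $\Delta_{\mathcal{Y}}$ be the set of probability distributions on $\mathcal{Y}$. If $h:\Delta_{\mathcal{Y}}\to\mathbb{R}$ is concave, then for every $\rho_1,\rho_2\in\Delta_{\mathcal{Y}}$ the function $$g((c_1,c_2))=(c_1+c_2)\,h\left(\frac{c_1\rho_1+c_2\rho_2}{c_1+c_2}\right),$$ defined for $(c_1,c_2)\in[0,\infty)^2\setminus\{(0,0)\}$, is concave.
   Context: $\Delta_{\mathcal{Y}}$ is regarded as a convex subset of $\mathbb{R}^{\mathcal{Y}}$, so convex combinations of distributions are taken pointwise. *)

theory Defs
  imports "HOL-Analysis.Analysis"
begin

text \<open>The finite set \<open>Y\<close> is the universe of a type \<open>'y\<close> of class \<open>finite\<close>; a distribution on it is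
  identified with its probability mass function, a vector indexed by \<open>'y\<close>.\<close>

definition prob_simplex :: "(real ^ 'y::finite) set" where
  "prob_simplex = {\<rho>. (\<forall>y. 0 \<le> \<rho> $ y) \<and> (\<Sum>y\<in>UNIV. \<rho> $ y) = 1}"

end

theory Submission
  imports Defs
begin

text \<open>The function \<open>g\<close> is the perspective of \<open>h\<close>, positively homogeneous of degree one, along the
  linear map \<open>(c\<^sub>1, c\<^sub>2) \<mapsto> c\<^sub>1 \<rho>\<^sub>1 + c\<^sub>2 \<rho>\<^sub>2\<close>. Normalising the weights \<open>u (c\<^sub>1 + c\<^sub>2)\<close>
  and \<open>v (d\<^sub>1 + d\<^sub>2)\<close> to sum to one turns concavity of \<open>h\<close> into concavity of \<open>g\<close>.\<close>

lemma convex_prob_simplex: "convex (prob_simplex :: (real ^ 'y::finite) set)"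
  unfolding convex_def prob_simplex_def
  by (simp add: sum.distrib flip: sum_distrib_left)

text \<open>Dividing by \<open>a + b\<close> gives weights that sum to one, so concavity of
  \<open>h\<close> applies; multiplying back by the positive total gives the bound. Only the total
  must be positive, so a single weight may vanish.\<close>

lemma concave_on_weighted:
  fixes h :: "'a::real_vector \<Rightarrow> real"
  assumes h: "concave_on S h" and pq: "p \<in> S" "q \<in> S"
    and ab: "0 \<le> a" "0 \<le> b" "0 < a + b"
  shows "a * h p + b * h q \<le> (a + b) * h ((a *\<^sub>R p + b *\<^sub>R q) /\<^sub>R (a + b))"
proof -
  have sum1: "a / (a + b) + b / (a + b) = 1"
    using ab by (simp flip: add_divide_distrib)
  have "a / (a + b) * h p + b / (a + b) * h q
      \<le> h ((a / (a + b)) *\<^sub>R p + (b / (a + b)) *\<^sub>R q)"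
    using h pq ab sum1 unfolding concave_on_iff by (meson divide_nonneg_pos)
  also have "(a / (a + b)) *\<^sub>R p + (b / (a + b)) *\<^sub>R q = (a *\<^sub>R p + b *\<^sub>R q) /\<^sub>R (a + b)"
    by (simp add: scaleR_add_right divide_inverse mult.commute)
  finally have "(a + b) * (a / (a + b) * h p + b / (a + b) * h q)
      \<le> (a + b) * h ((a *\<^sub>R p + b *\<^sub>R q) /\<^sub>R (a + b))"
    using ab by (intro mult_left_mono) auto
  moreover have "(a + b) * (a / (a + b) * h p + b / (a + b) * h q) = a * h p + b * h q"
    using ab by (simp add: distrib_left)
  ultimately show ?thesis by simp
qed

text \<open>Among points with nonnegative coordinates only the origin has coordinate sum zero, so
  deleting it amounts to intersecting with an open half-space.\<close>

lemma convex_quadrant_minus_origin: "convex ({0..} \<times> {0..} - {(0::real, 0::real)})"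
proof -
  have "{0..} \<times> {0..} - {(0::real, 0::real)} = ({0..} \<times> {0..}) \<inter> {x. (1, 1) \<bullet> x > 0}"
    by auto
  then show ?thesis
    by (simp add: convex_Int convex_Times convex_halfspace_gt)
qed

theorem lemmaE1:
  fixes h :: "real ^ 'y::finite \<Rightarrow> real"
    and \<rho>\<^sub>1 \<rho>\<^sub>2 :: "real ^ 'y"
  assumes "concave_on prob_simplex h"
    and "\<rho>\<^sub>1 \<in> prob_simplex" and "\<rho>\<^sub>2 \<in> prob_simplex"
  shows "concave_on ({0..} \<times> {0..} - {(0, 0)})
           (\<lambda>(c\<^sub>1::real, c\<^sub>2::real).
              (c\<^sub>1 + c\<^sub>2) * h ((c\<^sub>1 *\<^sub>R \<rho>\<^sub>1 + c\<^sub>2 *\<^sub>R \<rho>\<^sub>2) /\<^sub>R (c\<^sub>1 + c\<^sub>2)))"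
proof -
  let ?Q = "{0..} \<times> {0..} - {(0::real, 0::real)}"
  define mix where "mix c d = (c *\<^sub>R \<rho>\<^sub>1 + d *\<^sub>R \<rho>\<^sub>2) /\<^sub>R (c + d)" for c d :: real
  have pos: "0 \<le> c" "0 \<le> d" "0 < c + d" if "(c, d) \<in> ?Q" for c d
    using that by auto
  have mix_in: "mix c d \<in> prob_simplex" if "(c, d) \<in> ?Q" for c d
  proof -
    note p = pos[OF that]
    have "(c / (c + d)) *\<^sub>R \<rho>\<^sub>1 + (d / (c + d)) *\<^sub>R \<rho>\<^sub>2 \<in> prob_simplex"
      using p assms(2,3) by (intro convexD[OF convex_prob_simplex]) (auto simp flip: add_divide_distrib)
    then show ?thesis
      by (simp add: mix_def scaleR_add_right divide_inverse mult.commute)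
  qed
  \<comment> \<open>Clearing the denominator makes the mixture linear in the pair
    \<open>(c, d)\<close>, so that mixtures from two pairs can be added.\<close>
  have scale_mix: "(c + d) *\<^sub>R mix c d = c *\<^sub>R \<rho>\<^sub>1 + d *\<^sub>R \<rho>\<^sub>2" if "(c, d) \<in> ?Q" for c d
    using pos[OF that] by (simp add: mix_def)
  have "u * ((c + d) * h (mix c d)) + v * ((c' + d') * h (mix c' d'))
      \<le> (u * c + v * c' + (u * d + v * d')) * h (mix (u * c + v * c') (u * d + v * d'))"
    if x: "(c, d) \<in> ?Q" and y: "(c', d') \<in> ?Q" and uv: "0 \<le> u" "0 \<le> v" "u + v = 1"
    for c d c' d' u v
  proof -
    \<comment> \<open>These are the coefficients of \<open>h (mix c d)\<close> and
      \<open>h (mix c' d')\<close> on the left-hand side: \<open>u\<close> and \<open>v\<close>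
      times the total masses.\<close>
    let ?a = "u * (c + d)" and ?b = "v * (c' + d')"
    \<comment> \<open>The sum \<open>?a + ?b\<close> is the total mass of the combined pair.
      Convexity of \<open>?Q\<close> keeps that pair off the origin, so the sum is positive even
      when \<open>u\<close> or \<open>v\<close> is zero.\<close>
    have "(u * c + v * c', u * d + v * d') \<in> ?Q"
      using convexD[OF convex_quadrant_minus_origin x y uv] by simp
    from pos[OF this] have ab: "0 < ?a + ?b"
      by (simp add: algebra_simps)
    \<comment> \<open>Weighting the two mixtures by \<open>?a\<close> and \<open>?b\<close> and
      normalising yields exactly the mixture of the combined pair, the argument of \<open>h\<close>
      on the right-hand side.\<close>
    have "?a *\<^sub>R mix c d + ?b *\<^sub>R mix c' d' = u *\<^sub>R ((c + d) *\<^sub>R mix c d) + v *\<^sub>R ((c' + d') *\<^sub>R mix c' d')"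
      by simp
    also have "\<dots> = (u * c + v * c') *\<^sub>R \<rho>\<^sub>1 + (u * d + v * d') *\<^sub>R \<rho>\<^sub>2"
      unfolding scale_mix[OF x] scale_mix[OF y] by (simp add: algebra_simps)
    finally have "(?a *\<^sub>R mix c d + ?b *\<^sub>R mix c' d') /\<^sub>R (?a + ?b)
        = mix (u * c + v * c') (u * d + v * d')"
      by (simp add: mix_def algebra_simps)
    moreover have "?a * h (mix c d) + ?b * h (mix c' d')
        \<le> (?a + ?b) * h ((?a *\<^sub>R mix c d + ?b *\<^sub>R mix c' d') /\<^sub>R (?a + ?b))"
      using uv pos[OF x] pos[OF y] ab
      by (intro concave_on_weighted[OF assms(1) mix_in[OF x] mix_in[OF y]]) auto
    moreover have "?a + ?b = u * c + v * c' + (u * d + v * d')"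
      by (simp add: algebra_simps)
    ultimately show ?thesis
      by (simp add: mult.assoc)
  qed
  then show ?thesis
    unfolding concave_on_iff mix_def[symmetric]
    by (intro conjI ballI allI impI convex_quadrant_minus_origin)
      (simp only: split_paired_all scaleR_Pair add_Pair prod.case real_scaleR_def)
qed

end
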